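(* Let $G$ be a finite group of order $n$, such that the minimal degree of a nontrivial complex representation of $G$ is $k$. If $A, B, C$ are three subsets of $G$ such that $|A|\,|B|\,|C| > \frac{n^3}{k}$, then $A\cdot B\cdot C = G$. In particular, if $B\subseteq G$ satisfies $|B| > \frac{n}{k^{1/3}}$, then $B^3 = G$.
   Context: For subsets $A,B,C$ of a group, $A\cdot B\cdot C=\{abc : a\in A, b\in B, c\in C\}$ and $B^3=B\cdot B\cdot B$. A representation of $G$ is a homomorphism $G\to GL(d,\mathbb C)$, and $d$ is its degree; it is nontrivial if the homomorphism is not trivial. *)

theory Defs
  imports Complex_Main "HOL-Algebra.Coset" "Jordan_Normal_Form.Matrix"
begin

definition GL :: "nat \<Rightarrow> complex mat monoid" where
  "GL d = units_of (ring_mat TYPE(complex) d ())"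

lemma group_GL: "group (GL d)"
  unfolding GL_def
  by (intro monoid.units_group semiring.axioms(2) semiring_mat)

definition representation :: "('a, 'b) monoid_scheme \<Rightarrow> nat \<Rightarrow> ('a \<Rightarrow> complex mat) \<Rightarrow> bool" where
  "representation G d \<rho> \<longleftrightarrow> \<rho> \<in> hom G (GL d)"

definition nontrivial_representation ::
  "('a, 'b) monoid_scheme \<Rightarrow> nat \<Rightarrow> ('a \<Rightarrow> complex mat) \<Rightarrow> bool" where
  "nontrivial_representation G d \<rho> \<longleftrightarrow>
     representation G d \<rho> \<and> (\<exists>g\<in>carrier G. \<rho> g \<noteq> \<one>\<^bsub>GL d\<^esub>)"

(* A relation rather than a least-element function: the trivial group has no nontrivial
   representation, so for it no k qualifies.  Degree 0 never occurs, as GL 0 is trivial. *)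
definition is_min_nontrivial_degree :: "('a, 'b) monoid_scheme \<Rightarrow> nat \<Rightarrow> bool" where
  "is_min_nontrivial_degree G k \<longleftrightarrow>
     (\<exists>\<rho>. nontrivial_representation G k \<rho>) \<and>
     (\<forall>d \<rho>. nontrivial_representation G d \<rho> \<longrightarrow> k \<le> d)"

end

theory Submission
  imports Defs "HOL-Analysis.Function_Topology"
begin

text \<open>
  Let \<open>K\<close> be a real kernel on \<open>G \<times> G\<close> that is invariant under simultaneous right translation, and let
  \<open>l\<close> be the maximum of \<open>|K v|\<^sup>2\<close> over the unit vectors \<open>v\<close> of sum zero. The vectors attaining
  \<open>|K v|\<^sup>2 = l |v|\<^sup>2\<close> form a translation-invariant subspace. It contains no nonzero constant function,
  so it carries a nontrivial representation and has dimension at least \<open>k\<close>; summing over an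
  orthonormal basis gives \<open>k l \<le> \<Sum>\<^sub>x \<Sum>\<^sub>z K(x,z)\<^sup>2\<close>.
  Take \<open>K(x,z) = 1\<^sub>B(x z\<^sup>-\<^sup>1)\<close>, for which the right side is \<open>n|B|\<close>, and
  \<open>f = 1\<^sub>C - |C|/n\<close>. If \<open>g\<close> is not in \<open>A B C\<close>, then \<open>K f = -|B||C|/n\<close> on \<open>A\<^sup>-\<^sup>1 g\<close>, whence
  \<open>|A| (|B||C|/n)\<^sup>2 \<le> |K f|\<^sup>2 \<le> (n|B|/k) |C|\<close>, that is, \<open>|A||B||C| \<le> n\<^sup>3/k\<close>.
\<close>

section \<open>Orthonormal families of real functions on a finite set\<close>

text \<open>Functions are total on the type but only their values on \<open>S\<close> count, so the
  form is definite only up to equality on \<open>S\<close>. Expansions in orthonormal families are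
  therefore stated pointwise on \<open>S\<close>.\<close>

definition ip :: "'a set \<Rightarrow> ('a \<Rightarrow> real) \<Rightarrow> ('a \<Rightarrow> real) \<Rightarrow> real" where
  "ip S f g = (\<Sum>x\<in>S. f x * g x)"

definition kernel_op :: "'a set \<Rightarrow> ('a \<Rightarrow> 'a \<Rightarrow> real) \<Rightarrow> ('a \<Rightarrow> real) \<Rightarrow> 'a \<Rightarrow> real" where
  "kernel_op S K f x = (\<Sum>z\<in>S. K x z * f z)"

definition orthonormal_family :: "'a set \<Rightarrow> nat \<Rightarrow> (nat \<Rightarrow> 'a \<Rightarrow> real) \<Rightarrow> bool" where
  "orthonormal_family S d u \<longleftrightarrow> (\<forall>i<d. \<forall>j<d. ip S (u i) (u j) = (if i = j then 1 else 0))"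

definition fun_subspace :: "('a \<Rightarrow> real) set \<Rightarrow> bool" where
  "fun_subspace E \<longleftrightarrow> (\<lambda>x. 0) \<in> E \<and> (\<forall>f\<in>E. \<forall>g\<in>E. \<forall>a b. (\<lambda>x. a * f x + b * g x) \<in> E)"

lemma ip_commute: "ip S f g = ip S g f"
  unfolding ip_def by (simp add: mult.commute)

lemma ip_nonneg: "0 \<le> ip S f f"
  unfolding ip_def by (simp add: sum_nonneg)

lemma ip_lincomb_left:
  "ip S (\<lambda>x. a * f x + b * g x) h = a * ip S f h + b * ip S g h"
  unfolding ip_def by (simp add: sum.distrib sum_distrib_left algebra_simps)

lemma ip_sum_left:
  "ip S (\<lambda>x. \<Sum>i\<in>I. c i * u i x) h = (\<Sum>i\<in>I. c i * ip S (u i) h)"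
proof -
  have "ip S (\<lambda>x. \<Sum>i\<in>I. c i * u i x) h = (\<Sum>x\<in>S. \<Sum>i\<in>I. c i * (u i x * h x))"
    unfolding ip_def by (simp add: sum_distrib_right mult.assoc)
  also have "\<dots> = (\<Sum>i\<in>I. c i * ip S (u i) h)"
    unfolding ip_def by (subst sum.swap) (simp add: sum_distrib_left)
  finally show ?thesis .
qed

lemma ip_cong:
  assumes "\<And>x. x \<in> S \<Longrightarrow> f x = f' x" "\<And>x. x \<in> S \<Longrightarrow> g x = g' x"
  shows "ip S f g = ip S f' g'"
  unfolding ip_def using assms by simp

text \<open>Orthogonality of the projection residual serves twice: in Bessel's inequality and as the
  Gram-Schmidt step that enlarges an orthonormal family.\<close>

lemma ip_residual:
  assumes "orthonormal_family S d u" "j < d"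
  shows "ip S (\<lambda>x. w x - (\<Sum>i<d. ip S w (u i) * u i x)) (u j) = 0"
proof -
  have "ip S (\<lambda>x. w x - (\<Sum>i<d. ip S w (u i) * u i x)) (u j)
      = ip S w (u j) - (\<Sum>i<d. ip S w (u i) * ip S (u i) (u j))"
    using ip_lincomb_left[of S 1 w "-1" "\<lambda>x. \<Sum>i<d. ip S w (u i) * u i x" "u j"]
    by (simp add: ip_sum_left)
  also have "(\<Sum>i<d. ip S w (u i) * ip S (u i) (u j)) = (\<Sum>i<d. if i = j then ip S w (u j) else 0)"
    using assms unfolding orthonormal_family_def by (intro sum.cong) auto
  finally show ?thesis using assms(2) by simp
qed

text \<open>With \<open>?p\<close> the projection of \<open>w\<close> and \<open>?r\<close> the
  residual, orthogonality gives \<open>0 \<le> ip S ?r ?r = ip S w w - ip S ?p w\<close>, and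
  \<open>ip S ?p w\<close> is the sum of squared coefficients.\<close>

lemma bessel_inequality:
  assumes "orthonormal_family S d u"
  shows "(\<Sum>i<d. (ip S w (u i))\<^sup>2) \<le> ip S w w"
proof -
  let ?p = "\<lambda>x. \<Sum>i<d. ip S w (u i) * u i x"
  let ?r = "\<lambda>x. w x - ?p x"
  have "ip S ?p ?r = 0"
    unfolding ip_sum_left
    by (intro sum.neutral) (simp add: ip_commute[of S _ ?r] ip_residual[OF assms])
  moreover have "ip S ?r ?r = ip S w ?r - ip S ?p ?r"
    using ip_lincomb_left[of S 1 w "-1" ?p ?r] by simp
  moreover have "ip S w ?r = ip S w w - ip S ?p w"
    using ip_lincomb_left[of S 1 w "-1" ?p w] by (simp add: ip_commute)
  moreover have "ip S ?p w = (\<Sum>i<d. (ip S w (u i))\<^sup>2)"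
    unfolding ip_sum_left by (simp add: power2_eq_square ip_commute)
  ultimately show ?thesis using ip_nonneg[of S ?r] by simp
qed

text \<open>Bessel's inequality for the indicator of a point \<open>x\<close> bounds the sum of the
  \<open>(u i x)\<^sup>2\<close> by 1; summing over \<open>x\<close> bounds \<open>d\<close>, which
  is the sum of the squared norms.\<close>

lemma orthonormal_family_size_le:
  assumes "finite S" "orthonormal_family S d u"
  shows "d \<le> card S"
proof -
  have ev: "(\<Sum>i<d. (u i x)\<^sup>2) \<le> 1" if "x \<in> S" for x
  proof -
    let ?e = "\<lambda>y. if y = x then 1 else 0 :: real"
    have "ip S ?e g = g x" for g
      unfolding ip_def using that assms(1) by (simp add: if_distrib[of "\<lambda>t. t * _"] cong: if_cong)
    then show ?thesis using bessel_inequality[OF assms(2), of ?e] by simp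
  qed
  have "real d = (\<Sum>i<d. ip S (u i) (u i))"
    using assms(2) unfolding orthonormal_family_def by simp
  also have "\<dots> = (\<Sum>x\<in>S. \<Sum>i<d. (u i x)\<^sup>2)"
    unfolding ip_def by (subst sum.swap) (simp add: power2_eq_square)
  also have "\<dots> \<le> (\<Sum>x\<in>S. 1)" by (intro sum_mono ev)
  finally show ?thesis by simp
qed

lemma ip_self_eq_0:
  assumes "finite S" "ip S f f = 0" "x \<in> S"
  shows "f x = 0"
  using assms unfolding ip_def by (simp add: sum_nonneg_eq_0_iff)

lemma fun_subspace_sum:
  assumes "fun_subspace E" "\<And>i. i < d \<Longrightarrow> u i \<in> E"
  shows "(\<lambda>x. \<Sum>i<(d::nat). c i * u i x) \<in> E"
  using assms(2)
proof (induction d)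
  case 0
  then show ?case using assms(1) by (simp add: fun_subspace_def)
next
  case (Suc d)
  then have "(\<lambda>x. 1 * (\<Sum>i<d. c i * u i x) + c d * u d x) \<in> E"
    using assms(1) unfolding fun_subspace_def by (metis less_Suc_eq)
  then show ?case by simp
qed

text \<open>An orthonormal family in \<open>E\<close> of maximal size works, sizes being bounded by
  \<open>card S\<close>: if some \<open>f\<close> in \<open>E\<close> differed from its expansion on
  \<open>S\<close>, its normalized residual would extend the family.\<close>

lemma orthonormal_basis_exists:
  assumes "finite S" "fun_subspace E"
  obtains d u where "orthonormal_family S d u" "\<And>i. i < d \<Longrightarrow> u i \<in> E"
    "\<And>f x. f \<in> E \<Longrightarrow> x \<in> S \<Longrightarrow> f x = (\<Sum>i<d. ip S f (u i) * u i x)"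
proof -
  define P where "P d \<longleftrightarrow> (\<exists>u. orthonormal_family S d u \<and> (\<forall>i<d. u i \<in> E))" for d
  have P0: "P 0" by (simp add: P_def orthonormal_family_def)
  have bdd: "d \<le> card S" if "P d" for d
    using orthonormal_family_size_le[OF assms(1)] that by (auto simp: P_def)
  define d where "d = Greatest P"
  have "P d" unfolding d_def by (rule GreatestI_nat[where P = P and b = "card S", OF P0 bdd])
  have maxd: "d' \<le> d" if "P d'" for d'
    unfolding d_def by (rule Greatest_le_nat[where P = P and b = "card S", OF that bdd])
  from \<open>P d\<close> obtain u where u: "orthonormal_family S d u" and uE: "\<And>i. i < d \<Longrightarrow> u i \<in> E"
    unfolding P_def by blast
  have "f x = (\<Sum>i<d. ip S f (u i) * u i x)" if f: "f \<in> E" and x: "x \<in> S" for f x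
  proof (rule ccontr)
    assume ne: "\<not> ?thesis"
    define p where "p = (\<lambda>x. \<Sum>i<d. ip S f (u i) * u i x)"
    define r where "r = (\<lambda>x. f x - p x)"
    have pE: "p \<in> E" unfolding p_def by (rule fun_subspace_sum[OF assms(2) uE])
    have "r x \<noteq> 0" using ne by (simp add: r_def p_def)
    then have "ip S r r \<noteq> 0" using ip_self_eq_0[OF assms(1) _ x] by blast
    then have pos: "ip S r r > 0" using ip_nonneg[of S r] by simp
    define c where "c = 1 / sqrt (ip S r r)"
    define v where "v = (\<lambda>x. c * r x)"
    have vE: "v \<in> E"
    proof -
      have "(\<lambda>x. c * f x + (- c) * p x) \<in> E"
        using assms(2) f pE unfolding fun_subspace_def by blast
      then show ?thesis by (simp add: v_def r_def algebra_simps)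
    qed
    have ipv: "ip S v h = c * ip S r h" for h
      using ip_lincomb_left[of S c r 0 r h] by (simp add: v_def)
    have "ip S v v = c * c * ip S r r"
      by (simp add: ipv ip_commute[of S r v])
    then have vv: "ip S v v = 1"
      using pos by (simp add: c_def)
    have vu: "ip S v (u j) = 0" if "j < d" for j
      using ip_residual[OF u that, of f] by (simp add: ipv r_def p_def)
    have uv: "ip S (u j) v = 0" if "j < d" for j
      using vu[OF that] by (simp only: ip_commute[of S "u j"])
    have "orthonormal_family S (Suc d) (u(d := v))"
      using u vv vu uv unfolding orthonormal_family_def by (auto simp: less_Suc_eq)
    moreover have "\<forall>i<Suc d. (u(d := v)) i \<in> E"
      using uE vE by (auto simp: less_Suc_eq)
    ultimately have "P (Suc d)" unfolding P_def by blast
    then have "Suc d \<le> d" by (rule maxd)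
    then show False by simp
  qed
  then show thesis using that u uE by blast
qed

section \<open>Extremal vectors of a kernel operator\<close>

text \<open>The quadratic form attains its maximum on the compact unit sphere of sum-zero functions,
  and homogeneity of degree 2 extends the bound to all of them. The function \<open>f\<close> only
  witnesses that the sphere is nonempty.\<close>

lemma rayleigh_maximizer_exists:
  fixes K :: "'a \<Rightarrow> 'a \<Rightarrow> real" and f :: "'a \<Rightarrow> real"
  assumes "finite S" "x\<^sub>0 \<in> S" "f x\<^sub>0 \<noteq> 0" "sum f S = 0"
  obtains v where "sum v S = 0" "ip S v v = 1"
    "\<And>g. sum g S = 0 \<Longrightarrow>
      ip S (kernel_op S K g) (kernel_op S K g) \<le> ip S (kernel_op S K v) (kernel_op S K v) * ip S g g"
proof -
  let ?Q = "\<lambda>g. ip S (kernel_op S K g) (kernel_op S K g)"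
  \<comment> \<open>The type may be infinite, so functions are forced to vanish off
    \<open>S\<close>; the box is then compact by Tychonoff's theorem.\<close>
  define C where "C = (PiE UNIV (\<lambda>x. if x \<in> S then {-1..1::real} else {0}))"
  define D where "D = C \<inter> {g. sum g S = 0} \<inter> {g. ip S g g = 1}"
  have coord: "continuous_on UNIV (\<lambda>g::'a \<Rightarrow> real. g x)" for x
    by (rule continuous_on_product_coordinates)
  have "compactin (product_topology (\<lambda>_. euclidean) UNIV) C"
    unfolding C_def by (subst compactin_PiE) auto
  then have "compact C" by (simp add: euclidean_product_topology)
  moreover have "closed {g::'a \<Rightarrow> real. sum g S = 0}"
    by (intro closed_Collect_eq continuous_intros coord)
  moreover have "closed {g::'a \<Rightarrow> real. ip S g g = 1}"
    unfolding ip_def by (intro closed_Collect_eq continuous_intros coord)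
  ultimately have cD: "compact D" unfolding D_def by (intro compact_Int_closed)
  have contQ: "continuous_on D ?Q"
    unfolding ip_def kernel_op_def
    by (intro continuous_intros continuous_on_subset[OF coord]) auto
  \<comment> \<open>The scaled function is cut off outside \<open>S\<close> to lie in
    \<open>C\<close>. Agreement with \<open>g\<close> on \<open>S\<close> suffices, since
    \<open>ip\<close> and \<open>kernel_op\<close> sum over \<open>S\<close> only.\<close>
  have normalize: "\<exists>c h. h \<in> D \<and> c * c = ip S g g \<and> (\<forall>x\<in>S. g x = c * h x)"
    if s: "sum g S = 0" and nz: "ip S g g \<noteq> 0" for g
  proof -
    have pos: "ip S g g > 0" using nz ip_nonneg[of S g] by simp
    define c where "c = sqrt (ip S g g)"
    define h where "h = (\<lambda>x. if x \<in> S then g x / c else 0)"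
    have c: "c > 0" "c * c = ip S g g" using pos by (auto simp: c_def)
    have "ip S h h = ip S g g / (c * c)"
      unfolding ip_def by (simp add: h_def sum_divide_distrib)
    then have hh: "ip S h h = 1" using c nz by simp
    have "h x \<in> {-1..1}" if x: "x \<in> S" for x
    proof -
      have "h x * h x \<le> ip S h h"
        unfolding ip_def using assms(1) x by (intro member_le_sum) auto
      then have "(h x)\<^sup>2 \<le> 1" using hh by (simp add: power2_eq_square)
      then show ?thesis using abs_square_le_1[of "h x"] by auto
    qed
    then have "h \<in> C" unfolding C_def by (auto simp: h_def)
    moreover have "sum h S = 0" using s by (simp add: h_def flip: sum_divide_distrib)
    ultimately have "h \<in> D" using hh by (simp add: D_def)
    moreover have "\<forall>x\<in>S. g x = c * h x" using c by (simp add: h_def)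
    ultimately show ?thesis using c by blast
  qed
  have "ip S f f \<noteq> 0" using ip_self_eq_0[OF assms(1) _ assms(2)] assms(3) by blast
  then have "D \<noteq> {}" using normalize[OF assms(4)] by blast
  then obtain v where v: "v \<in> D" and vmax: "\<And>h. h \<in> D \<Longrightarrow> ?Q h \<le> ?Q v"
    using continuous_attains_sup[OF cD _ contQ] by blast
  have "?Q g \<le> ?Q v * ip S g g" if s: "sum g S = 0" for g
  proof (cases "ip S g g = 0")
    case True
    then have "\<forall>x\<in>S. g x = 0" using ip_self_eq_0[OF assms(1)] by blast
    then have "?Q g = 0" by (simp add: ip_def kernel_op_def)
    then show ?thesis using True by simp
  next
    case False
    then obtain c h where h: "h \<in> D" "c * c = ip S g g" "\<forall>x\<in>S. g x = c * h x"
      using normalize[OF s] by blast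
    have "kernel_op S K g = (\<lambda>x. c * kernel_op S K h x)"
      using h(3) unfolding kernel_op_def by (auto simp: sum_distrib_left algebra_simps intro!: sum.cong)
    then have "?Q g = (c * c) * ?Q h"
      unfolding ip_def by (simp add: sum_distrib_left algebra_simps)
    then show ?thesis using vmax[OF h(1)] h(2) ip_nonneg[of S g]
      by (metis mult.commute mult_left_mono)
  qed
  then show thesis using that v by (auto simp: D_def)
qed

text \<open>
  The null vectors of a positive semidefinite form are a subspace, so no adjoint of the operator and
  no eigenvalue equation is needed.
\<close>

lemma extremal_fun_subspace:
  assumes le: "\<And>g. sum g S = 0 \<Longrightarrow> ip S (kernel_op S K g) (kernel_op S K g) \<le> l * ip S g g"
  shows "fun_subspace {g. sum g S = 0 \<and> ip S (kernel_op S K g) (kernel_op S K g) = l * ip S g g}"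
proof -
  \<comment> \<open>This symmetric bilinear form is positive semidefinite on sum-zero functions, and
    the extremal vectors are the sum-zero \<open>g\<close> with \<open>B g g = 0\<close>.\<close>
  define B where "B f g = l * ip S f g - ip S (kernel_op S K f) (kernel_op S K g)" for f g
  have klin: "kernel_op S K (\<lambda>x. a * f x + b * g x) = (\<lambda>x. a * kernel_op S K f x + b * kernel_op S K g x)"
    for a b f g
    by (auto simp: kernel_op_def sum.distrib sum_distrib_left algebra_simps)
  have Bl: "B (\<lambda>x. a * f x + b * g x) h = a * B f h + b * B g h" for a b f g h
    by (simp add: B_def ip_lincomb_left klin algebra_simps)
  have Bc: "B f g = B g f" for f g by (simp add: B_def ip_commute)
  have Bq: "B (\<lambda>x. a * f x + b * g x) (\<lambda>x. a * f x + b * g x)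
      = a * a * B f f + 2 * a * b * B f g + b * b * B g g" for a b f g
    by (simp add: Bl Bc[of _ "\<lambda>x. a * f x + b * g x"] algebra_simps) (simp add: Bc)
  have sl: "sum (\<lambda>x. a * f x + b * g x) S = a * sum f S + b * sum g S" for a b and f g :: "'a \<Rightarrow> real"
    by (simp add: sum.distrib sum_distrib_left)
  have pos: "B g g \<ge> 0" if "sum g S = 0" for g using le[OF that] by (simp add: B_def)
  have mem: "B g g = 0 \<longleftrightarrow> ip S (kernel_op S K g) (kernel_op S K g) = l * ip S g g" for g
    by (auto simp: B_def)
  show ?thesis unfolding fun_subspace_def mem[symmetric]
  proof (intro conjI ballI allI)
    show "(\<lambda>x. 0) \<in> {g. sum g S = 0 \<and> B g g = 0}"
      by (simp add: B_def ip_def kernel_op_def)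
    fix f g a b
    assume "f \<in> {g. sum g S = 0 \<and> B g g = 0}" "g \<in> {g. sum g S = 0 \<and> B g g = 0}"
    then have f: "sum f S = 0" "B f f = 0" and g: "sum g S = 0" "B g g = 0" by auto
    \<comment> \<open>Since \<open>B f f\<close> and \<open>B g g\<close> vanish, the form takes the
      values \<open>2 * B f g\<close> and \<open>- 2 * B f g\<close> at the sum and the difference;
      both are nonnegative, so \<open>B f g = 0\<close>.\<close>
    have "B f g \<ge> 0" using pos[of "\<lambda>x. 1 * f x + 1 * g x"] Bq[of 1 f 1 g] sl[of 1 f 1 g] f g by simp
    moreover have "B f g \<le> 0" using pos[of "\<lambda>x. 1 * f x + (-1) * g x"] Bq[of 1 f "-1" g] sl[of 1 f "-1" g] f g by simp
    ultimately show "(\<lambda>x. a * f x + b * g x) \<in> {g. sum g S = 0 \<and> B g g = 0}"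
      using sl[of a f b g] Bq[of a f b g] f g by simp
  qed
qed

text \<open>The value of \<open>kernel_op S K (u i)\<close> at \<open>x\<close> is the inner product
  of the row \<open>K x\<close> with \<open>u i\<close>. Bessel's inequality for each row, summed
  over the rows, gives the squared Hilbert-Schmidt norm.\<close>

lemma kernel_op_orthonormal_bound:
  assumes "orthonormal_family S d u"
  shows "(\<Sum>i<d. ip S (kernel_op S K (u i)) (kernel_op S K (u i))) \<le> (\<Sum>x\<in>S. \<Sum>z\<in>S. (K x z)\<^sup>2)"
proof -
  have "(\<Sum>i<d. ip S (kernel_op S K (u i)) (kernel_op S K (u i)))
      = (\<Sum>x\<in>S. \<Sum>i<d. (ip S (K x) (u i))\<^sup>2)"
    unfolding ip_def kernel_op_def by (subst sum.swap) (simp add: power2_eq_square)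
  also have "\<dots> \<le> (\<Sum>x\<in>S. ip S (K x) (K x))"
    by (intro sum_mono bessel_inequality assms)
  finally show ?thesis by (simp add: ip_def power2_eq_square)
qed

section \<open>Right translation and the representations it induces\<close>

lemma (in group) ip_translate:
  assumes "g \<in> carrier G"
  shows "ip (carrier G) (\<lambda>x. f (x \<otimes> g)) (\<lambda>x. h (x \<otimes> g)) = ip (carrier G) f h"
  unfolding ip_def
  by (rule sum.reindex_bij_betw[of "\<lambda>x. x \<otimes> g" _ _ "\<lambda>x. f x * h x"])
    (rule bij_betw_byWitness[where f' = "\<lambda>x. x \<otimes> inv g"]; use assms in \<open>auto simp: m_assoc\<close>)

lemma (in group) sum_translate:
  fixes f :: "'a \<Rightarrow> real"
  assumes "g \<in> carrier G"
  shows "(\<Sum>x\<in>carrier G. f (x \<otimes> g)) = sum f (carrier G)"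
  using ip_translate[OF assms, of f "\<lambda>_. 1"] by (simp add: ip_def)

text \<open>Right translation \<open>f \<mapsto> f(\<cdot> g)\<close> is a left action, hence no inverse of \<open>g\<close> in \<open>\<rho>\<close>.\<close>

lemma (in group) representation_of_invariant_subspace:
  assumes u: "orthonormal_family (carrier G) d u" and uE: "\<And>i. i < d \<Longrightarrow> u i \<in> E"
    and exp: "\<And>f x. f \<in> E \<Longrightarrow> x \<in> carrier G \<Longrightarrow> f x = (\<Sum>i<d. ip (carrier G) f (u i) * u i x)"
    and inv: "\<And>f g. f \<in> E \<Longrightarrow> g \<in> carrier G \<Longrightarrow> (\<lambda>x. f (x \<otimes> g)) \<in> E"
  defines "\<rho> \<equiv> \<lambda>g. mat d d (\<lambda>(i, j). complex_of_real (ip (carrier G) (\<lambda>x. u j (x \<otimes> g)) (u i)))"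
  shows "representation G d \<rho>"
proof -
  let ?S = "carrier G"
  define m where "m g i j = ip ?S (\<lambda>x. u j (x \<otimes> g)) (u i)" for g i j
  have rho: "\<rho> g = mat d d (\<lambda>(i, j). complex_of_real (m g i j))" for g
    by (simp add: \<rho>_def m_def)
  have mm: "m (g \<otimes> h) i j = (\<Sum>l<d. m g i l * m h l j)"
    if gh: "g \<in> ?S" "h \<in> ?S" and ij: "i < d" "j < d" for g h i j
  proof -
    \<comment> \<open>The translate of \<open>u j\<close> by \<open>h\<close> lies in
      \<open>E\<close>; its basis expansion is evaluated at the point
      \<open>x \<otimes> g\<close>.\<close>
    have "u j (x \<otimes> (g \<otimes> h)) = (\<Sum>l<d. m h l j * u l (x \<otimes> g))" if "x \<in> ?S" for x
      using exp[OF inv[OF uE[OF ij(2)] gh(2)], of "x \<otimes> g"] gh that by (simp add: m_def m_assoc)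
    then have "m (g \<otimes> h) i j = ip ?S (\<lambda>x. \<Sum>l<d. m h l j * u l (x \<otimes> g)) (u i)"
      unfolding m_def[of "g \<otimes> h"] by (intro ip_cong) auto
    then show ?thesis by (simp add: ip_sum_left m_def[of g] mult.commute)
  qed
  have mult: "\<rho> (g \<otimes> h) = \<rho> g * \<rho> h" if "g \<in> ?S" "h \<in> ?S" for g h
    by (rule eq_matI)
      (simp_all add: rho mm[OF that] scalar_prod_def lessThan_atLeast0 of_real_sum)
  have one: "\<rho> \<one> = 1\<^sub>m d"
  proof (rule eq_matI)
    fix i j assume "i < dim_row (1\<^sub>m d :: complex mat)" "j < dim_col (1\<^sub>m d :: complex mat)"
    then have ij: "i < d" "j < d" by auto
    have "m \<one> i j = ip ?S (u j) (u i)" unfolding m_def by (intro ip_cong) auto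
    then show "\<rho> \<one> $$ (i, j) = 1\<^sub>m d $$ (i, j)"
      using u ij by (auto simp: rho orthonormal_family_def)
  qed (auto simp: rho)
  have units: "\<rho> g \<in> Units (ring_mat TYPE(complex) d ())" if g: "g \<in> ?S" for g
  proof -
    have "\<rho> g * \<rho> (inv g) = 1\<^sub>m d" "\<rho> (inv g) * \<rho> g = 1\<^sub>m d"
      using mult[of g "inv g"] mult[of "inv g" g] g one by simp_all
    moreover have "\<rho> x \<in> carrier_mat d d" for x by (simp add: rho)
    ultimately show ?thesis unfolding Units_def by (auto simp: ring_mat_def)
  qed
  show ?thesis
    unfolding representation_def GL_def hom_def
    using units mult by (auto simp: units_of_def ring_mat_def)
qed

lemma one_GL: "\<one>\<^bsub>GL d\<^esub> = 1\<^sub>m d"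
  by (simp add: GL_def units_of_def ring_mat_def)

text \<open>All 0 by 0 matrices are equal, so degree 0 admits only the trivial homomorphism.
  Positivity allows multiplying out the bounds divided by \<open>k\<close>.\<close>

lemma min_nontrivial_degree_pos:
  assumes "is_min_nontrivial_degree G k"
  shows "k > 0"
proof (rule ccontr)
  assume "\<not> k > 0"
  then obtain \<rho> g where "representation G 0 \<rho>" "g \<in> carrier G" "\<rho> g \<noteq> 1\<^sub>m 0"
    using assms by (auto simp: is_min_nontrivial_degree_def nontrivial_representation_def one_GL)
  moreover from this have "\<rho> g \<in> carrier_mat 0 0"
    by (auto simp: representation_def GL_def hom_def units_of_def Units_def ring_mat_def)
  ultimately show False by (auto intro: eq_matI)
qed

section \<open>Norm bound for translation-invariant kernels\<close>

text \<open>Cauchy-Schwarz alone gives the inequality without the factor \<open>k\<close>. The gain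
  comes from multiplicity: the top value on sum-zero functions is attained on a space of dimension
  at least \<open>k\<close>.\<close>

lemma (in group) invariant_kernel_bound:
  assumes fin: "finite (carrier G)" and k: "is_min_nontrivial_degree G k"
    and K: "\<And>x z g. \<lbrakk>x \<in> carrier G; z \<in> carrier G; g \<in> carrier G\<rbrakk> \<Longrightarrow> K (x \<otimes> g) (z \<otimes> g) = K x z"
    and f0: "sum f (carrier G) = 0"
  shows "real k * ip (carrier G) (kernel_op (carrier G) K f) (kernel_op (carrier G) K f)
    \<le> (\<Sum>x\<in>carrier G. \<Sum>z\<in>carrier G. (K x z)\<^sup>2) * ip (carrier G) f f"
proof (cases "\<exists>x\<in>carrier G. f x \<noteq> 0")
  case False
  then show ?thesis by (simp add: ip_def kernel_op_def)
next
  case True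
  let ?S = "carrier G"
  let ?T = "kernel_op ?S K"
  obtain v where v: "sum v ?S = 0" "ip ?S v v = 1"
    and vmax: "\<And>g. sum g ?S = 0 \<Longrightarrow> ip ?S (?T g) (?T g) \<le> ip ?S (?T v) (?T v) * ip ?S g g"
    using True rayleigh_maximizer_exists[OF fin _ _ f0] by blast
  define l where "l = ip ?S (?T v) (?T v)"
  define E where "E = {g. sum g ?S = 0 \<and> ip ?S (?T g) (?T g) = l * ip ?S g g}"
  have sub: "fun_subspace E"
    unfolding E_def using vmax by (intro extremal_fun_subspace) (simp add: l_def)
  have vE: "v \<in> E" using v by (simp add: E_def l_def)
  have inv: "(\<lambda>x. h (x \<otimes> g)) \<in> E" if h: "h \<in> E" and g: "g \<in> ?S" for h g
  proof -
    \<comment> \<open>Invariance of \<open>K\<close> and the substitution of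
      \<open>z \<otimes> g\<close> for \<open>z\<close> make the operator commute with right
      translation.\<close>
    have "?T (\<lambda>x. h (x \<otimes> g)) x = ?T h (x \<otimes> g)" if x: "x \<in> ?S" for x
    proof -
      have "?T (\<lambda>x. h (x \<otimes> g)) x = (\<Sum>z\<in>?S. K (x \<otimes> g) (z \<otimes> g) * h (z \<otimes> g))"
        unfolding kernel_op_def using K x g by simp
      then show ?thesis
        using sum_translate[OF g, of "\<lambda>z. K (x \<otimes> g) z * h z"] by (simp add: kernel_op_def)
    qed
    then have "ip ?S (?T (\<lambda>x. h (x \<otimes> g))) (?T (\<lambda>x. h (x \<otimes> g)))
        = ip ?S (\<lambda>x. ?T h (x \<otimes> g)) (\<lambda>x. ?T h (x \<otimes> g))"
      by (intro ip_cong)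
    also have "\<dots> = ip ?S (?T h) (?T h)" by (rule ip_translate[OF g])
    finally have "ip ?S (?T (\<lambda>x. h (x \<otimes> g))) (?T (\<lambda>x. h (x \<otimes> g))) = ip ?S (?T h) (?T h)" .
    then show ?thesis using h by (simp add: E_def ip_translate[OF g] sum_translate[OF g])
  qed
  obtain d u where u: "orthonormal_family ?S d u" and uE: "\<And>i. i < d \<Longrightarrow> u i \<in> E"
    and exp: "\<And>f x. f \<in> E \<Longrightarrow> x \<in> ?S \<Longrightarrow> f x = (\<Sum>i<d. ip ?S f (u i) * u i x)"
    using orthonormal_basis_exists[OF fin sub] by blast
  define \<rho> where "\<rho> = (\<lambda>g. mat d d (\<lambda>(i, j). complex_of_real (ip ?S (\<lambda>x. u j (x \<otimes> g)) (u i))))"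
  have rep: "representation G d \<rho>"
    unfolding \<rho>_def by (rule representation_of_invariant_subspace[OF u uE exp inv])
  \<comment> \<open>If every \<open>\<rho> g\<close> were the identity, each \<open>u j\<close>
    would equal all its translates and so be constant on the group. Having sum zero it would vanish,
    and then so would the unit vector \<open>v\<close>.\<close>
  have "nontrivial_representation G d \<rho>"
  proof (rule ccontr)
    assume "\<not> ?thesis"
    then have triv: "\<rho> g = 1\<^sub>m d" if "g \<in> ?S" for g
      using rep that by (auto simp: nontrivial_representation_def one_GL)
    have const: "u j g = u j \<one>" if j: "j < d" and g: "g \<in> ?S" for j g
    proof -
      have "ip ?S (\<lambda>x. u j (x \<otimes> g)) (u i) = (if i = j then 1 else 0)" if i: "i < d" for i
      proof -
        have "\<rho> g $$ (i, j) = (1\<^sub>m d :: complex mat) $$ (i, j)" using triv[OF g] by simp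
        then show ?thesis using i j by (simp add: \<rho>_def split: if_splits)
      qed
      then have "(\<lambda>x. u j (x \<otimes> g)) \<one> = (\<Sum>i<d. (if i = j then 1 else 0) * u i \<one>)"
        using exp[OF inv[OF uE[OF j] g], of \<one>] by simp
      also have "\<dots> = u j \<one>" using j by (simp add: if_distrib[of "\<lambda>t. t * _"] cong: if_cong)
      finally show ?thesis using g by simp
    qed
    have u0: "u j x = 0" if j: "j < d" and x: "x \<in> ?S" for j x
    proof -
      have "sum (u j) ?S = (\<Sum>x\<in>?S. u j \<one>)"
        by (intro sum.cong const j refl)
      then have "real (card ?S) * u j \<one> = 0"
        using uE[OF j] by (simp add: E_def)
      moreover have "card ?S \<noteq> 0" using fin by auto
      ultimately show ?thesis using const[OF j x] by simp
    qed
    have "v x = 0" if "x \<in> ?S" for x using exp[OF vE that] u0 that by simp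
    then show False using v(2) by (simp add: ip_def)
  qed
  then have kd: "k \<le> d" using k by (auto simp: is_min_nontrivial_degree_def)
  have lpos: "l \<ge> 0" unfolding l_def by (rule ip_nonneg)
  have "ip ?S (?T (u i)) (?T (u i)) = l" if "i < d" for i
    using uE[OF that] u that by (simp add: E_def orthonormal_family_def)
  then have "real d * l = (\<Sum>i<d. ip ?S (?T (u i)) (?T (u i)))" by simp
  also have "\<dots> \<le> (\<Sum>x\<in>?S. \<Sum>z\<in>?S. (K x z)\<^sup>2)" by (rule kernel_op_orthonormal_bound[OF u])
  finally have "real k * l \<le> (\<Sum>x\<in>?S. \<Sum>z\<in>?S. (K x z)\<^sup>2)"
    using kd lpos by (meson mult_right_mono of_nat_mono order_trans)
  then have "real k * l * ip ?S f f \<le> (\<Sum>x\<in>?S. \<Sum>z\<in>?S. (K x z)\<^sup>2) * ip ?S f f"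
    using ip_nonneg by (intro mult_right_mono)
  moreover have "real k * ip ?S (?T f) (?T f) \<le> real k * (l * ip ?S f f)"
    using vmax[OF f0] by (intro mult_left_mono) (auto simp: l_def)
  ultimately show ?thesis by (simp add: mult.assoc)
qed

section \<open>Application to products of three sets\<close>

lemma (in group) triple_product_eq_carrier:
  assumes fin: "finite (carrier G)" and k: "is_min_nontrivial_degree G k"
    and sub: "A \<subseteq> carrier G" "B \<subseteq> carrier G" "C \<subseteq> carrier G"
    and gt: "real (card A) * real (card B) * real (card C) > real (order G) ^ 3 / real k"
  shows "A <#> B <#> C = carrier G"
proof (rule ccontr)
  assume ne: "\<not> ?thesis"
  let ?S = "carrier G"
  have "A <#> B <#> C \<subseteq> ?S" using sub by (intro set_mult_closed)
  then obtain g where g: "g \<in> ?S" "g \<notin> A <#> B <#> C" using ne by blast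
  define n where "n = real (card ?S)"
  have n: "n > 0" unfolding n_def using fin by (auto simp: card_gt_0_iff)
  define a b c where "a = real (card A)" and "b = real (card B)" and "c = real (card C)"
  \<comment> \<open>With this kernel, \<open>?T f\<close> is the convolution of the indicator of
    \<open>B\<close> with \<open>f\<close>, the indicator of \<open>C\<close> minus its
    mean.\<close>
  define K where "K x z = (if x \<otimes> inv z \<in> B then 1 else 0 :: real)" for x z
  define f where "f z = (if z \<in> C then 1 else 0) - c / n" for z
  let ?T = "kernel_op ?S K"
  have sC: "(\<Sum>z\<in>?S. if z \<in> C then 1 else 0 :: real) = c"
    using fin sub by (simp add: c_def Int_absorb1 flip: sum.inter_restrict)
  have Ksum: "(\<Sum>z\<in>?S. K x z) = b" if x: "x \<in> ?S" for x
  proof -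
    \<comment> \<open>The condition that \<open>x \<otimes> inv z\<close> equals \<open>y\<close>
      has the unique solution \<open>z = inv y \<otimes> x\<close>, so each row of \<open>K\<close>
      has exactly \<open>card B\<close> ones.\<close>
    have "{z \<in> ?S. x \<otimes> inv z \<in> B} = (\<lambda>y. inv y \<otimes> x) ` B"
    proof (intro equalityI subsetI)
      fix z assume "z \<in> {z \<in> ?S. x \<otimes> inv z \<in> B}"
      then have "z \<in> ?S" "x \<otimes> inv z \<in> B" by auto
      moreover from this have "z = inv (x \<otimes> inv z) \<otimes> x"
        using x by (simp add: inv_mult_group m_assoc)
      ultimately show "z \<in> (\<lambda>y. inv y \<otimes> x) ` B" by blast
    next
      fix z assume "z \<in> (\<lambda>y. inv y \<otimes> x) ` B"
      then obtain y where y: "y \<in> B" "z = inv y \<otimes> x" by blast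
      moreover have "y \<in> ?S" using y sub by blast
      moreover from this have "x \<otimes> inv (inv y \<otimes> x) = y"
        using x by (simp add: inv_mult_group m_assoc[symmetric])
      ultimately show "z \<in> {z \<in> ?S. x \<otimes> inv z \<in> B}" using x by simp
    qed
    moreover have "inj_on (\<lambda>y. inv y \<otimes> x) B"
      using x sub by (intro inj_onI) (metis inv_closed inv_inv right_cancel subsetD)
    ultimately have "card {z \<in> ?S. x \<otimes> inv z \<in> B} = card B" by (simp add: card_image)
    then show ?thesis unfolding K_def b_def using fin by (simp flip: sum.inter_filter)
  qed
  have Kinv: "K (x \<otimes> h) (z \<otimes> h) = K x z" if "x \<in> ?S" "z \<in> ?S" "h \<in> ?S" for x z h
  proof -
    have "(x \<otimes> h) \<otimes> inv (z \<otimes> h) = x \<otimes> (h \<otimes> inv h) \<otimes> inv z"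
      using that by (simp only: inv_mult_group m_assoc m_closed inv_closed)
    then show ?thesis unfolding K_def using that by simp
  qed
  have "(\<Sum>x\<in>?S. \<Sum>z\<in>?S. (K x z)\<^sup>2) = (\<Sum>x\<in>?S. \<Sum>z\<in>?S. K x z)"
    by (intro sum.cong) (auto simp: K_def)
  then have HS: "(\<Sum>x\<in>?S. \<Sum>z\<in>?S. (K x z)\<^sup>2) = n * b" by (simp add: Ksum n_def)
  have f0: "sum f ?S = 0" using n unfolding f_def by (simp add: sum_subtractf sC n_def)
  have "ip ?S f f = (\<Sum>z\<in>?S. (1 - 2 * (c / n)) * (if z \<in> C then 1 else 0) + (c / n)\<^sup>2)"
    unfolding ip_def by (intro sum.cong) (auto simp: f_def power2_eq_square algebra_simps)
  also have "\<dots> = (1 - 2 * (c / n)) * c + n * (c / n)\<^sup>2"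
    by (simp add: sum.distrib sC n_def flip: sum_distrib_left)
  also have "\<dots> = c - c\<^sup>2 / n" using n by (simp add: field_simps power2_eq_square)
  also have "\<dots> \<le> c" using n by simp
  finally have ff: "ip ?S f f \<le> c" .
  \<comment> \<open>These are the points \<open>x\<close> with \<open>y \<otimes> x = g\<close> for
    some \<open>y\<close> in \<open>A\<close>, on which the missing element \<open>g\<close>
    determines \<open>?T f\<close>.\<close>
  define A' where "A' = (\<lambda>y. inv y \<otimes> g) ` A"
  have A': "A' \<subseteq> ?S" using sub g by (auto simp: A'_def)
  have "inj_on (\<lambda>y. inv y \<otimes> g) A"
    using g sub by (intro inj_onI) (metis inv_closed inv_inv right_cancel subsetD)
  then have cardA': "real (card A') = a" by (simp add: A'_def a_def card_image)
  have TA: "?T f x = - (b * c / n)" if x: "x \<in> A'" for x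
  proof -
    obtain y where y: "y \<in> A" "x = inv y \<otimes> g" using x by (auto simp: A'_def)
    have yS: "y \<in> ?S" and xS: "x \<in> ?S" using y(1) sub A' x by auto
    \<comment> \<open>If \<open>z\<close> were in \<open>C\<close> and
      \<open>x \<otimes> inv z\<close> in \<open>B\<close>, then
      \<open>g = y \<otimes> (x \<otimes> inv z) \<otimes> z\<close> would lie in the product. Hence
      wherever \<open>K x z\<close> is nonzero, \<open>f z\<close> is
      \<open>- (c / n)\<close>.\<close>
    have "K x z * f z = - (c / n) * K x z" if z: "z \<in> ?S" for z
    proof (cases "z \<in> C \<and> x \<otimes> inv z \<in> B")
      case True
      have "y \<otimes> x = g" using yS g(1) y(2) by (simp flip: m_assoc)
      then have "y \<otimes> (x \<otimes> inv z) \<otimes> z = g" using yS xS z by (simp add: m_assoc)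
      then have "g \<in> A <#> B <#> C" using True y(1) by (auto simp: set_mult_def)
      then show ?thesis using g by simp
    qed (auto simp: K_def f_def)
    then have "?T f x = (\<Sum>z\<in>?S. - (c / n) * K x z)" unfolding kernel_op_def by simp
    also have "\<dots> = - (c / n) * b" by (simp only: sum_distrib_left[symmetric] Ksum[OF xS])
    finally show ?thesis by (simp add: mult.commute)
  qed
  have "a * (b * c / n)\<^sup>2 = (\<Sum>x\<in>A'. ?T f x * ?T f x)"
    by (simp add: TA cardA' power2_eq_square)
  also have "\<dots> \<le> ip ?S (?T f) (?T f)"
    unfolding ip_def using fin A' by (intro sum_mono2) auto
  finally have "real k * (a * (b * c / n)\<^sup>2) \<le> real k * ip ?S (?T f) (?T f)"
    by (intro mult_left_mono) auto
  also have "\<dots> \<le> n * b * ip ?S f f"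
    using invariant_kernel_bound[where K = K, OF fin k Kinv f0] by (simp add: HS)
  also have "\<dots> \<le> n * b * c" using ff n by (intro mult_left_mono) (auto simp: b_def)
  finally have main: "real k * (a * (b * c / n)\<^sup>2) \<le> n * b * c" .
  have kpos: "real k > 0" using min_nontrivial_degree_pos[OF k] by simp
  have gt': "a * b * c > n ^ 3 / real k" using gt by (simp add: a_def b_def c_def n_def order_def)
  \<comment> \<open>Strict positivity of the product excludes empty sets, so that
    \<open>b * c\<close> can be cancelled from \<open>main\<close>.\<close>
  then have "a * b * c > 0" using n kpos by (smt (verit) divide_pos_pos zero_less_power)
  then have bc: "b * c > 0" by (simp add: a_def b_def c_def zero_less_mult_iff)
  have "(b * c) * (real k * (a * b * c)) \<le> (b * c) * n ^ 3"
    using main n by (simp add: field_simps power2_eq_square power3_eq_cube)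
  then have "real k * (a * b * c) \<le> n ^ 3" using bc by (simp only: mult_le_cancel_left_pos)
  then show False using gt' kpos by (simp add: field_simps)
qed

theorem corollary1:
  fixes G :: "('a, 'b) monoid_scheme" and n k :: nat
  assumes "group G"
    and "finite (carrier G)"
    and "order G = n"
    and "is_min_nontrivial_degree G k"
  shows "(\<forall>A B C. A \<subseteq> carrier G \<and> B \<subseteq> carrier G \<and> C \<subseteq> carrier G \<and>
            real (card A) * real (card B) * real (card C) > real n ^ 3 / real k
            \<longrightarrow> A <#>\<^bsub>G\<^esub> B <#>\<^bsub>G\<^esub> C = carrier G) \<and>
         (\<forall>B. B \<subseteq> carrier G \<and> real (card B) > real n / real k powr (1 / 3)
            \<longrightarrow> B <#>\<^bsub>G\<^esub> B <#>\<^bsub>G\<^esub> B = carrier G)"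
proof -
  have *: "A <#>\<^bsub>G\<^esub> B <#>\<^bsub>G\<^esub> C = carrier G"
    if "A \<subseteq> carrier G" "B \<subseteq> carrier G" "C \<subseteq> carrier G"
      "real (card A) * real (card B) * real (card C) > real n ^ 3 / real k" for A B C
    using group.triple_product_eq_carrier[OF assms(1,2,4) that(1-3)] that(4) assms(3) by simp
  \<comment> \<open>Cubing both nonnegative sides turns the one-set hypothesis into the three-set
    one with all sets equal to \<open>B\<close>.\<close>
  have "real (card B) * real (card B) * real (card B) > real n ^ 3 / real k"
    if "real (card B) > real n / real k powr (1 / 3)" for B :: "'a set"
  proof -
    have "(real k powr (1 / 3)) ^ 3 = real k"
      using min_nontrivial_degree_pos[OF assms(4)] by (simp add: powr_power)
    then have "real n ^ 3 / real k = (real n / real k powr (1 / 3)) ^ 3"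
      by (simp add: power_divide)
    also have "\<dots> < real (card B) ^ 3" using that by (intro power_strict_mono) auto
    finally show ?thesis by (simp add: power3_eq_cube)
  qed
  then show ?thesis using * by blast
qed

end
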